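(* Let $\langle v_i\rangle_{i\ge1}$ and $\langle\pi_i\rangle_{i\ge0}$ be the sequences generated by DPI or by IPI, starting from an admissible policy $\pi_0$ and under the boundary condition that, for every $i\in\mathbb N$, if $\pi_{i-1}$ is admissible then $\lim_{t\to\infty}\mathbb G_{\pi_{i-1}}^x[\gamma^tv_i(X_t)]=0$ for all $x\in\mathcal X$. Let $\hat v_*(x)=\sup_{i\in\mathbb N}v_i(x)$. Assume: (i) for each $x\in\mathcal X$, the correspondence $p\mapsto\arg\max_{u\in\mathcal U}h(x,u,p)$ has a closed graph, i.e., for any sequence $\langle p_k\rangle$ in $\mathcal X^{\mathsf T}$ converging to $p_*$, if $u_k\in\arg\max_{u\in\mathcal U}h(x,u,p_k)$ for all $k$ and $\lim_{k\to\infty}u_k=\bar u\in\mathcal U$, then $\bar u\in\arg\max_{u\in\mathcal U}h(x,u,p_* )$; (ii) $\langle\nabla v_i\rangle$ converges locally uniformly, and $\langle\pi_i\rangle$ converges pointwise (to a function $\mathcal X\to\mathcal U$). Then $v_*=\hat v_*$ is a solution of the Hamilton–Jacobi–Bellman equation $\alpha v_*(x)=\max_{u\in\mathcal U}h(x,u,\nabla v_*(x))$ for all $x\in\mathcal X$, such that $v_*\in\mathrm C^1$ and (1) $v_i\to v_*$ and $\nabla v_i\to\nabla v_*$, both locally uniformly; (2) $\pi_i\to\pi_*$ pointwise, for a function $\pi_*:\mathcal X\to\mathcal U$ satisfying $\pi_*(x)\in\arg\max_{u\in\mathcal U}h(x,u,\nabla v_*(x))$ for all $x\in\mathcal X$.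
   Context: State space $\mathcal X=\mathbb R^l$, $\mathcal X^{\mathsf T}=\mathbb R^{1\times l}$, time space $\mathbb T=[0,\infty)$. The action space $\mathcal U\subseteq\mathbb R^m$ is an $m$-dimensional manifold with or without boundary, meaning $\mathcal U=O\cup\partial O$ or $\mathcal U=O$ for some open $O\subseteq\mathbb R^m$. The environment is $\dot X_t=f(X_t,U_t)$, with $f:\mathcal X\times\mathcal U\to\mathcal X$ continuous and $t\mapsto U_t\in\mathcal U$ continuous; it is a standing assumption that the state trajectory $t\mapsto X_t$ is uniquely defined over all of $\mathbb T$ (for every initial state, in particular under every policy). A policy is a continuous function $\pi:\mathcal X\to\mathcal U$. $\mathbb G_\pi^x[Y]$ denotes the value of $Y$ when $X_0=x$ and $U_t=\pi(X_t)$ for all $t\in\mathbb T$. The reward function $r:\mathcal X\times\mathcal U\to\mathbb R$ is continuous, $R_t=r(X_t,U_t)$; $\gamma\in(0,1]$ is the discount factor and $\alpha=-\ln\gamma\ge0$. Standing assumption: $r$ attains a maximum $r_{\mathsf{max}}$, and $r_{\mathsf{max}}=0$ if $\gamma=1$. The value function (VF) of $\pi$ is $v_\pi(x)=\mathbb G_\pi^x[\int_0^\infty\gamma^tR_t\,dt]\in[-\infty,\infty)$. A policy $\pi$ is admissible iff $v_\pi(x)$ is finite for all $x\in\mathcal X$. Standing assumption: at least one admissible policy exists, and every admissible VF is $\mathrm C^1$. Gradients are row vectors, and the Hamiltonian is $h(x,u,p)=r(x,u)+p\,f(x,u)$. Standing assumption: there is a continuous $u_*:\mathcal X\times\mathcal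 X^{\mathsf T}\to\mathcal U$ with $u_*(x,p)\in\arg\max_{u\in\mathcal U}h(x,u,p)$ for all $(x,p)$. DPI (differential policy iteration): given an admissible policy $\pi_0$, for $i=1,2,\dots$: (evaluation) $v_i:\mathcal X\to\mathbb R$ is a $\mathrm C^1$ function with $\alpha v_i(x)=h(x,\pi_{i-1}(x),\nabla v_i(x))$ for all $x$; (improvement) $\pi_i$ is a policy with $\pi_i(x)\in\arg\max_{u\in\mathcal U}h(x,u,\nabla v_i(x))$ for all $x$. IPI (integral policy iteration): given an admissible policy $\pi_0$ and a fixed $\eta>0$, for $i=1,2,\dots$: (evaluation) $v_i:\mathcal X\to\mathbb R$ is a $\mathrm C^1$ function with $v_i(x)=\mathbb G_{\pi_{i-1}}^x[\int_0^\eta\gamma^tR_t\,dt+\gamma^\eta v_i(X_\eta)]$ for all $x$; (improvement) $\pi_i$ is a policy with $\pi_i(x)\in\arg\max_{u\in\mathcal U}[r(x,u)+\nabla v_i(x)f_{\mathsf c}(x,u)]$ for all $x$, where $f(x,u)=f_{\mathsf d}(x)+f_{\mathsf c}(x,u)$ with $f_{\mathsf d},f_{\mathsf c}$ continuous (the same argmax set as for $h(x,\cdot,\nabla v_i(x))$). Locally uniform convergence means each $x\in\mathcal X$ has a neighborhood on which convergence is uniform. *)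

theory Defs
  imports "HOL-Analysis.Analysis"
begin

text \<open>
  States live in \<open>real ^ 'l\<close>, actions in a subset \<open>\<U>\<close> of \<open>real ^ 'm\<close>.  Row vectors (gradients
  and the costate \<open>p\<close>) are also elements of \<open>real ^ 'l\<close>; the product of a row and a column
  vector is the inner product.  Functions on \<open>\<X> \<times> \<U>\<close> are total HOL functions that are only
  constrained and only evaluated at actions in \<open>\<U>\<close>; time-dependent functions only matter on
  \<open>{0..}\<close>.
\<close>

subsection \<open>Calculus\<close>

definition grad :: "('a::real_inner \<Rightarrow> real) \<Rightarrow> 'a \<Rightarrow> 'a" where
  "grad v x = (THE D. GDERIV v x :> D)"

definition C1 :: "('a::real_inner \<Rightarrow> real) \<Rightarrow> bool" where
  "C1 v \<longleftrightarrow> (\<forall>x. v differentiable (at x)) \<and> continuous_on UNIV (grad v)"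

definition locally_uniform_limit ::
    "(nat \<Rightarrow> 'a::topological_space \<Rightarrow> 'b::metric_space) \<Rightarrow> ('a \<Rightarrow> 'b) \<Rightarrow> bool" where
  "locally_uniform_limit F g \<longleftrightarrow>
     (\<forall>x. \<exists>N. open N \<and> x \<in> N \<and> uniform_limit N F g sequentially)"

definition is_maximum :: "'b::order \<Rightarrow> 'b set \<Rightarrow> bool" where
  "is_maximum m S \<longleftrightarrow> m \<in> S \<and> (\<forall>y\<in>S. y \<le> m)"

definition argmax :: "'a set \<Rightarrow> ('a \<Rightarrow> real) \<Rightarrow> 'a set" where
  "argmax S g = {u. is_arg_max g (\<lambda>u. u \<in> S) u}"

subsection \<open>Environment and policies\<close>

definition action_manifold :: "'b::topological_space set \<Rightarrow> bool" where
  "action_manifold \<U> \<longleftrightarrow> (\<exists>O'. open O' \<and> (\<U> = O' \<union> frontier O' \<or> \<U> = O'))"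

definition policy :: "(real ^ 'm) set \<Rightarrow> (real ^ 'l \<Rightarrow> real ^ 'm) \<Rightarrow> bool" where
  "policy \<U> \<pi> \<longleftrightarrow> continuous_on UNIV \<pi> \<and> range \<pi> \<subseteq> \<U>"

text \<open>\<open>X\<close> solves the dynamics from \<open>x\<close> when the state-dependent action \<open>\<mu> t y\<close> is applied
  at time \<open>t\<close> in state \<open>y\<close>.  A policy is the time-independent case; an action trajectory is
  the state-independent case.\<close>

definition trajectory ::
    "(real ^ 'l \<Rightarrow> real ^ 'm \<Rightarrow> real ^ 'l) \<Rightarrow> (real \<Rightarrow> real ^ 'l \<Rightarrow> real ^ 'm) \<Rightarrow> real ^ 'l
      \<Rightarrow> (real \<Rightarrow> real ^ 'l) \<Rightarrow> bool" where
  "trajectory f \<mu> x X \<longleftrightarrow> X 0 = x \<and>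
     (\<forall>t\<ge>0. (X has_vector_derivative f (X t) (\<mu> t (X t))) (at t within {0..}))"

definition unique_trajectory ::
    "(real ^ 'l \<Rightarrow> real ^ 'm \<Rightarrow> real ^ 'l) \<Rightarrow> (real \<Rightarrow> real ^ 'l \<Rightarrow> real ^ 'm) \<Rightarrow> real ^ 'l
      \<Rightarrow> bool" where
  "unique_trajectory f \<mu> x \<longleftrightarrow> (\<exists>X. trajectory f \<mu> x X) \<and>
     (\<forall>X Y. trajectory f \<mu> x X \<longrightarrow> trajectory f \<mu> x Y \<longrightarrow> (\<forall>t\<ge>0. X t = Y t))"

text \<open>The trajectory underlying the values \<open>\<GG>\<^sub>\<pi>\<^sup>x[\<dots>]\<close>.  Under unique existence its
  values at times \<open>t \<ge> 0\<close> do not depend on the choice made by \<open>SOME\<close>.\<close>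

definition traj ::
    "(real ^ 'l \<Rightarrow> real ^ 'm \<Rightarrow> real ^ 'l) \<Rightarrow> (real ^ 'l \<Rightarrow> real ^ 'm) \<Rightarrow> real ^ 'l
      \<Rightarrow> real \<Rightarrow> real ^ 'l" where
  "traj f \<pi> x = (SOME X. trajectory f (\<lambda>t. \<pi>) x X)"

subsection \<open>Values and the Hamiltonian\<close>

text \<open>\<open>\<GG>\<^sub>\<pi>\<^sup>x[\<integral>\<^sub>0\<^sup>T \<gamma>\<^sup>t R\<^sub>t dt]\<close>\<close>

definition disc_return ::
    "(real ^ 'l \<Rightarrow> real ^ 'm \<Rightarrow> real ^ 'l) \<Rightarrow> (real ^ 'l \<Rightarrow> real ^ 'm \<Rightarrow> real) \<Rightarrow> real
      \<Rightarrow> (real ^ 'l \<Rightarrow> real ^ 'm) \<Rightarrow> real ^ 'l \<Rightarrow> real \<Rightarrow> real" where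
  "disc_return f r \<gamma> \<pi> x T =
     integral {0..T} (\<lambda>t. \<gamma> powr t * r (traj f \<pi> x t) (\<pi> (traj f \<pi> x t)))"

text \<open>The integral over \<open>[0, \<infinity>)\<close>, which may be \<open>-\<infinity>\<close>.  The limit exists in \<open>ereal\<close> when
  \<open>r \<le> r_max\<close>, with \<open>r_max = 0\<close> if \<open>\<gamma> = 1\<close>: the integral of \<open>\<gamma> powr t * (R t - r_max)\<close> over
  \<open>{0..T}\<close> decreases in \<open>T\<close>.\<close>

definition value_fun ::
    "(real ^ 'l \<Rightarrow> real ^ 'm \<Rightarrow> real ^ 'l) \<Rightarrow> (real ^ 'l \<Rightarrow> real ^ 'm \<Rightarrow> real) \<Rightarrow> real
      \<Rightarrow> (real ^ 'l \<Rightarrow> real ^ 'm) \<Rightarrow> real ^ 'l \<Rightarrow> ereal" where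
  "value_fun f r \<gamma> \<pi> x = Lim at_top (\<lambda>T. ereal (disc_return f r \<gamma> \<pi> x T))"

definition admissible ::
    "(real ^ 'm) set \<Rightarrow> (real ^ 'l \<Rightarrow> real ^ 'm \<Rightarrow> real ^ 'l) \<Rightarrow> (real ^ 'l \<Rightarrow> real ^ 'm \<Rightarrow> real)
      \<Rightarrow> real \<Rightarrow> (real ^ 'l \<Rightarrow> real ^ 'm) \<Rightarrow> bool" where
  "admissible \<U> f r \<gamma> \<pi> \<longleftrightarrow> policy \<U> \<pi> \<and> (\<forall>x. \<bar>value_fun f r \<gamma> \<pi> x\<bar> \<noteq> \<infinity>)"

definition hamiltonian ::
    "(real ^ 'l \<Rightarrow> real ^ 'm \<Rightarrow> real ^ 'l) \<Rightarrow> (real ^ 'l \<Rightarrow> real ^ 'm \<Rightarrow> real)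
      \<Rightarrow> real ^ 'l \<Rightarrow> real ^ 'm \<Rightarrow> real ^ 'l \<Rightarrow> real" where
  "hamiltonian f r x u p = r x u + p \<bullet> f x u"

subsection \<open>Standing assumptions\<close>

definition standing_assumptions ::
    "(real ^ 'm) set \<Rightarrow> (real ^ 'l \<Rightarrow> real ^ 'm \<Rightarrow> real ^ 'l) \<Rightarrow> (real ^ 'l \<Rightarrow> real ^ 'm \<Rightarrow> real)
      \<Rightarrow> real \<Rightarrow> bool" where
  "standing_assumptions \<U> f r \<gamma> \<longleftrightarrow>
     action_manifold \<U> \<and>
     continuous_on (UNIV \<times> \<U>) (\<lambda>(x, u). f x u) \<and>
     continuous_on (UNIV \<times> \<U>) (\<lambda>(x, u). r x u) \<and>
     0 < \<gamma> \<and> \<gamma> \<le> 1 \<and>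
     (\<forall>\<omega> x. continuous_on {0..} \<omega> \<and> \<omega> ` {0..} \<subseteq> \<U> \<longrightarrow> unique_trajectory f (\<lambda>t y. \<omega> t) x) \<and>
     (\<forall>\<pi> x. policy \<U> \<pi> \<longrightarrow> unique_trajectory f (\<lambda>t. \<pi>) x) \<and>
     (\<exists>r_max. is_maximum r_max {r x u | x u. u \<in> \<U>} \<and> (\<gamma> = 1 \<longrightarrow> r_max = 0)) \<and>
     (\<exists>\<pi>. admissible \<U> f r \<gamma> \<pi>) \<and>
     (\<forall>\<pi>. admissible \<U> f r \<gamma> \<pi> \<longrightarrow> C1 (\<lambda>x. real_of_ereal (value_fun f r \<gamma> \<pi> x))) \<and>
     (\<exists>u_star. continuous_on UNIV (\<lambda>(x, p). u_star x p) \<and>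
        (\<forall>x p. u_star x p \<in> argmax \<U> (\<lambda>u. hamiltonian f r x u p)))"

subsection \<open>Policy iteration\<close>

text \<open>In both schemes \<open>v\<close> is indexed from 1 (\<open>v 0\<close> is irrelevant) and \<open>\<pi>\<close> from 0.
  The discount rate \<open>\<alpha>\<close> is \<open>- ln \<gamma>\<close>.\<close>

definition DPI ::
    "(real ^ 'm) set \<Rightarrow> (real ^ 'l \<Rightarrow> real ^ 'm \<Rightarrow> real ^ 'l) \<Rightarrow> (real ^ 'l \<Rightarrow> real ^ 'm \<Rightarrow> real)
      \<Rightarrow> real \<Rightarrow> (nat \<Rightarrow> real ^ 'l \<Rightarrow> real) \<Rightarrow> (nat \<Rightarrow> real ^ 'l \<Rightarrow> real ^ 'm) \<Rightarrow> bool" where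
  "DPI \<U> f r \<gamma> v \<pi> \<longleftrightarrow>
     (\<forall>i\<ge>1. C1 (v i) \<and>
        (\<forall>x. - ln \<gamma> * v i x = hamiltonian f r x (\<pi> (i - 1) x) (grad (v i) x)) \<and>
        policy \<U> (\<pi> i) \<and>
        (\<forall>x. \<pi> i x \<in> argmax \<U> (\<lambda>u. hamiltonian f r x u (grad (v i) x))))"

definition IPI ::
    "(real ^ 'm) set \<Rightarrow> (real ^ 'l \<Rightarrow> real ^ 'm \<Rightarrow> real ^ 'l) \<Rightarrow> (real ^ 'l \<Rightarrow> real ^ 'm \<Rightarrow> real)
      \<Rightarrow> real \<Rightarrow> real \<Rightarrow> (real ^ 'l \<Rightarrow> real ^ 'm \<Rightarrow> real ^ 'l)
      \<Rightarrow> (nat \<Rightarrow> real ^ 'l \<Rightarrow> real) \<Rightarrow> (nat \<Rightarrow> real ^ 'l \<Rightarrow> real ^ 'm) \<Rightarrow> bool" where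
  "IPI \<U> f r \<gamma> \<eta> f\<^sub>c v \<pi> \<longleftrightarrow>
     (\<forall>i\<ge>1. C1 (v i) \<and>
        (\<forall>x. v i x = disc_return f r \<gamma> (\<pi> (i - 1)) x \<eta>
                     + \<gamma> powr \<eta> * v i (traj f (\<pi> (i - 1)) x \<eta>)) \<and>
        policy \<U> (\<pi> i) \<and>
        (\<forall>x. \<pi> i x \<in> argmax \<U> (\<lambda>u. r x u + grad (v i) x \<bullet> f\<^sub>c x u)))"

definition input_decomposition ::
    "(real ^ 'm) set \<Rightarrow> (real ^ 'l \<Rightarrow> real ^ 'm \<Rightarrow> real ^ 'l)
      \<Rightarrow> (real ^ 'l \<Rightarrow> real ^ 'l) \<Rightarrow> (real ^ 'l \<Rightarrow> real ^ 'm \<Rightarrow> real ^ 'l) \<Rightarrow> bool" where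
  "input_decomposition \<U> f f\<^sub>d f\<^sub>c \<longleftrightarrow>
     continuous_on UNIV f\<^sub>d \<and> continuous_on (UNIV \<times> \<U>) (\<lambda>(x, u). f\<^sub>c x u) \<and>
     (\<forall>x. \<forall>u\<in>\<U>. f x u = f\<^sub>d x + f\<^sub>c x u)"

end

theory Submission
  imports Defs
begin

text \<open>
  Along a trajectory of \<open>\<pi>\<close>, the derivative of \<open>\<gamma>\<^sup>t w(X\<^sub>t)\<close> plus the discounted reward is
  \<open>\<gamma>\<^sup>t (h(X\<^sub>t, \<pi>(X\<^sub>t), \<nabla>w(X\<^sub>t)) - \<alpha> w(X\<^sub>t))\<close>.  Together with the boundary condition this
  identifies \<open>v\<^sub>i\<close> with the value function of \<open>\<pi>\<^sub>i\<^sub>-\<^sub>1\<close> in both schemes (in IPI by iterating the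
  evaluation step along multiples of \<open>\<eta>\<close>, after which differentiation at time 0 gives the DPI
  equation).  It also yields policy improvement: a greedy policy makes the integrand nonnegative, and
  \<open>v\<^sub>i \<le> r_max / \<alpha>\<close> bounds the terminal term from above, so the new policy is admissible and at
  least as good.  Hence \<open>v\<^sub>i\<close> increases to a finite limit, locally uniformly because its gradients
  converge locally uniformly.  Passing to the limit in the evaluation equation and in the greedy
  condition (closed graph) gives the HJB equation.
\<close>

section \<open>Gradients\<close>

text \<open>Uniqueness for the definite description in \<open>grad\<close>; existence comes with
  \<open>GDERIV_grad\<close>.\<close>

lemma GDERIV_unique:
  fixes v :: "'a::real_inner \<Rightarrow> real"
  assumes "GDERIV v x :> D" "GDERIV v x :> E"
  shows "D = E"
proof -
  have "(\<lambda>h. inner h D) = (\<lambda>h. inner h E)"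
    using assms unfolding gderiv_def by (rule has_derivative_unique)
  then have "inner h D = inner h E" for h
    by (rule fun_cong)
  then show ?thesis
    using vector_eq_ldot by blast
qed

lemma grad_eqI:
  assumes "GDERIV v x :> D"
  shows "grad v x = D"
  unfolding grad_def using assms by (blast intro: the_equality GDERIV_unique)

text \<open>In finite dimension a linear functional is the inner product with the vector of its
  values on the basis, and this vector is the gradient.\<close>

lemma GDERIV_grad:
  fixes v :: "'a::euclidean_space \<Rightarrow> real"
  assumes "v differentiable at x"
  shows "GDERIV v x :> grad v x"
proof -
  obtain v' where v': "(v has_derivative v') (at x)"
    using assms unfolding differentiable_def by blast
  then have lin: "linear v'"
    by (rule has_derivative_linear)
  have "v' h = inner h (\<Sum>b\<in>Basis. v' b *\<^sub>R b)" for h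
  proof -
    have "v' h = v' (\<Sum>b\<in>Basis. inner h b *\<^sub>R b)"
      by (simp add: euclidean_representation)
    also have "\<dots> = (\<Sum>b\<in>Basis. inner h b * v' b)"
      using lin by (simp add: linear_sum linear_scale)
    finally show ?thesis
      by (simp add: inner_sum_right mult.commute)
  qed
  then have "v' = (\<lambda>h. inner h (\<Sum>b\<in>Basis. v' b *\<^sub>R b))"
    by (rule ext)
  then have "GDERIV v x :> (\<Sum>b\<in>Basis. v' b *\<^sub>R b)"
    using v' unfolding gderiv_def by simp
  then show ?thesis
    using grad_eqI by metis
qed

lemma C1_GDERIV:
  fixes v :: "'a::euclidean_space \<Rightarrow> real"
  assumes "C1 v"
  shows "GDERIV v x :> grad v x"
  using assms GDERIV_grad unfolding C1_def by blast

lemma C1_const: "C1 (\<lambda>x::'a::euclidean_space. c)" and grad_const: "grad (\<lambda>x::'a. c) x = 0"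
proof -
  show g: "grad (\<lambda>x::'a. c) x = 0" for x
    by (rule grad_eqI) (rule GDERIV_const)
  show "C1 (\<lambda>x::'a. c)"
    unfolding C1_def by (simp add: g)
qed

lemma C1_continuous_on:
  assumes "C1 v"
  shows "continuous_on S v"
  using assms unfolding C1_def
  by (meson differentiable_imp_continuous_within continuous_at_imp_continuous_on)

text \<open>On a ball, uniform convergence of the gradients allows differentiating the limit, makes
  \<open>g\<close> continuous, and by a mean value estimate upgrades pointwise to uniform
  convergence.\<close>

lemma C1_limit:
  fixes v :: "nat \<Rightarrow> 'a::euclidean_space \<Rightarrow> real"
  assumes C1: "\<And>i. C1 (v i)"
    and lim: "\<And>x. (\<lambda>i. v i x) \<longlonglongrightarrow> V x"
    and grads: "locally_uniform_limit (\<lambda>i. grad (v i)) g"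
  shows "C1 V" and "grad V = g" and "locally_uniform_limit v V"
proof -
  have local: "GDERIV V x :> g x \<and> continuous (at x) g \<and>
      (\<exists>N. open N \<and> x \<in> N \<and> uniform_limit N v V sequentially)" for x
  proof -
    obtain N where N: "open N" "x \<in> N" and uN: "uniform_limit N (\<lambda>i. grad (v i)) g sequentially"
      using grads unfolding locally_uniform_limit_def by blast
    obtain e where e: "e > 0" "ball x e \<subseteq> N"
      using N open_contains_ball by blast
    \<comment> \<open>A ball, since the mean value estimates need convexity and its radius enters
      the choice of \<open>c\<close> below.\<close>
    define S where "S = ball x e"
    have S: "convex S" "open S" "x \<in> S"
      using e by (auto simp: S_def)
    have uS: "uniform_limit S (\<lambda>i. grad (v i)) g sequentially"
      using uniform_limit_on_subset[OF uN] e S_def by blast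
    have deriv: "(v n has_derivative (\<lambda>h. inner h (grad (v n) y))) (at y within S)" for n y
      using C1_GDERIV[OF C1] unfolding gderiv_def by (rule has_derivative_at_withinI)
    have close: "\<forall>\<^sub>F n in sequentially. \<forall>y\<in>S. \<forall>h.
        norm (inner h (grad (v n) y) - inner h (g y)) \<le> d * norm h" if "d > 0" for d
      using uniform_limitD[OF uS that]
    proof eventually_elim
      case (elim n)
      have "norm (inner h (grad (v n) y) - inner h (g y)) \<le> d * norm h" if "y \<in> S" for y h
      proof -
        have "norm (inner h (grad (v n) y) - inner h (g y)) \<le> norm h * norm (grad (v n) y - g y)"
          by (metis Cauchy_Schwarz_ineq2 inner_diff_right real_norm_def)
        also have "\<dots> \<le> norm h * d"
          using elim that by (intro mult_left_mono) (auto simp: dist_norm less_imp_le)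
        finally show ?thesis
          by (simp add: mult.commute)
      qed
      then show ?case
        by blast
    qed
    \<comment> \<open>\<open>has_derivative_sequence\<close> yields its own limit function, which
      agrees with \<open>V\<close> on \<open>S\<close> by uniqueness of limits.\<close>
    obtain V' where V': "\<forall>y\<in>S. (\<lambda>n. v n y) \<longlonglongrightarrow> V' y \<and>
        (V' has_derivative (\<lambda>h. inner h (g y))) (at y within S)"
      using has_derivative_sequence[OF S(1) deriv close S(3) lim[of x]] by blast
    then have "V' y = V y" if "y \<in> S" for y
      using that LIMSEQ_unique[OF _ lim[of y]] by blast
    then have "(V has_derivative (\<lambda>h. inner h (g x))) (at x within S)"
      by (intro has_derivative_transform[of x S V V']) (use V' S(3) in auto)
    then have der: "GDERIV V x :> g x"
      unfolding gderiv_def using at_within_open[OF S(3,2)] by simp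
    have "continuous_on S (grad (v n))" for n
    proof (rule continuous_on_subset[OF _ subset_UNIV])
      show "continuous_on UNIV (grad (v n))"
        using C1[of n] unfolding C1_def ..
    qed
    then have "continuous_on S g"
      by (intro uniform_limit_theorem[OF _ uS] always_eventually) auto
    then have cont: "continuous (at x) g"
      using continuous_on_eq_continuous_at[OF S(2)] S(3) by blast
    have "uniform_limit S v V sequentially"
    proof (rule uniform_limitI)
      fix d :: real
      assume "d > 0"
      \<comment> \<open>Chosen so that the error \<open>v n - V\<close> varies by at most d/4
        between \<open>x\<close> and any point of the ball; its value at \<open>x\<close> is
        eventually below d/4, so the total stays below \<open>d\<close>.\<close>
      define c where "c = d / (4 * e)"
      have c: "c > 0" "c * e = d / 4"
        using \<open>d > 0\<close> e by (auto simp: c_def)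
      have "\<exists>M. \<forall>m\<ge>M. \<forall>n\<ge>M. \<forall>y\<in>S. \<forall>z\<in>S.
          norm ((v m y - v n y) - (v m z - v n z)) \<le> c * norm (y - z)"
        by (rule has_derivative_sequence_Lipschitz[OF S(1) deriv close c(1)])
      then obtain M where M: "\<forall>m\<ge>M. \<forall>n\<ge>M. \<forall>y\<in>S. \<forall>z\<in>S.
          norm ((v m y - v n y) - (v m z - v n z)) \<le> c * norm (y - z)" ..
      have "\<forall>\<^sub>F n in sequentially. dist (v n x) (V x) < d / 4"
        using tendstoD[OF lim[of x], of "d/4"] \<open>d > 0\<close> by simp
      then show "\<forall>\<^sub>F n in sequentially. \<forall>y\<in>S. dist (v n y) (V y) < d"
        using eventually_ge_at_top[of M]
      proof eventually_elim
        case (elim n)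
        show ?case
        proof
          fix y
          assume y: "y \<in> S"
          \<comment> \<open>Letting m tend to infinity in the Cauchy estimate replaces
            \<open>v m\<close> by \<open>V\<close>.\<close>
          have "norm ((v n y - V y) - (v n x - V x)) \<le> c * norm (y - x)"
          proof (rule tendsto_upperbound)
            show "(\<lambda>m. norm ((v n y - v m y) - (v n x - v m x))) \<longlonglongrightarrow>
                norm ((v n y - V y) - (v n x - V x))"
              by (intro tendsto_intros lim)
            show "\<forall>\<^sub>F m in sequentially.
                norm ((v n y - v m y) - (v n x - v m x)) \<le> c * norm (y - x)"
              using eventually_ge_at_top[of M] by eventually_elim (use M elim y S(3) in blast)
          qed simp
          also have "\<dots> \<le> c * e"
            using y c by (auto simp: S_def dist_norm norm_minus_commute)
          finally show "dist (v n y) (V y) < d"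
            using elim c \<open>d > 0\<close> unfolding dist_real_def real_norm_def by linarith
        qed
      qed
    qed
    then show ?thesis
      using der cont S by blast
  qed
  show g: "grad V = g"
    using local grad_eqI by blast
  show "C1 V"
    unfolding C1_def g using local
    by (auto simp: gderiv_def differentiable_def intro!: continuous_at_imp_continuous_on)
  show "locally_uniform_limit v V"
    unfolding locally_uniform_limit_def using local by blast
qed

lemma uniform_limit_offset_iff:
  "uniform_limit S (\<lambda>i. F (i + k)) g sequentially \<longleftrightarrow> uniform_limit S F g sequentially"
  unfolding uniform_limit_iff
  using eventually_sequentially_seg[of "\<lambda>n. \<forall>x\<in>S. dist (F n x) (g x) < e" k for e] by simp

text \<open>For passing between \<open>v\<close> and its shift by one: the iteration says nothing
  about \<open>v 0\<close>.\<close>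

lemma locally_uniform_limit_offset_iff:
  "locally_uniform_limit (\<lambda>i. F (i + k)) g \<longleftrightarrow> locally_uniform_limit F g"
  unfolding locally_uniform_limit_def uniform_limit_offset_iff ..

text \<open>Stated for complete linear orders so as to apply in \<open>ereal\<close>, where the
  limit may be minus infinity.\<close>

lemma antimono_on_tendsto_at_top:
  fixes d :: "real \<Rightarrow> 'a::{complete_linorder, linorder_topology}"
  assumes "\<And>s t. a \<le> s \<Longrightarrow> s \<le> t \<Longrightarrow> d t \<le> d s"
  shows "(d \<longlongrightarrow> (INF t\<in>{a..}. d t)) at_top"
proof (rule order_tendstoI)
  fix y
  assume "y < (INF t\<in>{a..}. d t)"
  then have "y < d t" if "t \<ge> a" for t
    using that by (meson INF_lower atLeast_iff less_le_trans)
  then show "\<forall>\<^sub>F t in at_top. y < d t"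
    using eventually_ge_at_top[of a] by (rule eventually_mono[rotated])
next
  fix y
  assume "(INF t\<in>{a..}. d t) < y"
  then obtain s where "s \<ge> a" "d s < y"
    by (auto simp: INF_less_iff)
  then have "d t < y" if "t \<ge> s" for t
    using that assms by (meson le_less_trans)
  then show "\<forall>\<^sub>F t in at_top. d t < y"
    using eventually_ge_at_top[of s] by (rule eventually_mono[rotated])
qed

section \<open>Trajectories and returns of a policy\<close>

locale control_problem =
  fixes \<U> :: "(real ^ 'm) set"
    and f :: "real ^ 'l \<Rightarrow> real ^ 'm \<Rightarrow> real ^ 'l"
    and r :: "real ^ 'l \<Rightarrow> real ^ 'm \<Rightarrow> real"
    and \<gamma> :: real
  assumes standing: "standing_assumptions \<U> f r \<gamma>"
begin

abbreviation "X \<equiv> traj f"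
abbreviation "D \<equiv> disc_return f r \<gamma>"
abbreviation "H \<equiv> hamiltonian f r"

text \<open>Meant for admissible policies; elsewhere \<open>real_of_ereal\<close> would turn an
  infinite value into 0.\<close>

definition val :: "(real ^ 'l \<Rightarrow> real ^ 'm) \<Rightarrow> real ^ 'l \<Rightarrow> real" where
  "val \<pi> x = real_of_ereal (value_fun f r \<gamma> \<pi> x)"

lemma continuous_f: "continuous_on (UNIV \<times> \<U>) (\<lambda>(x, u). f x u)"
  and continuous_r: "continuous_on (UNIV \<times> \<U>) (\<lambda>(x, u). r x u)"
  and \<gamma>: "0 < \<gamma>" "\<gamma> \<le> 1"
  and unique_policy: "policy \<U> \<pi> \<Longrightarrow> unique_trajectory f (\<lambda>t. \<pi>) x"
  and reward_maximum: "\<exists>r_max. is_maximum r_max {r x u | x u. u \<in> \<U>} \<and> (\<gamma> = 1 \<longrightarrow> r_max = 0)"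
  using standing unfolding standing_assumptions_def by blast+

lemma trajectory_traj:
  assumes "policy \<U> \<pi>"
  shows "trajectory f (\<lambda>t. \<pi>) x (X \<pi> x)"
proof -
  have "\<exists>Y. trajectory f (\<lambda>t. \<pi>) x Y"
    using unique_policy[OF assms] unfolding unique_trajectory_def by blast
  then show ?thesis
    unfolding traj_def by (rule someI_ex)
qed

lemma traj_0 [simp]: "policy \<U> \<pi> \<Longrightarrow> X \<pi> x 0 = x"
  using trajectory_traj unfolding trajectory_def by blast

lemma traj_has_vector_derivative:
  assumes "policy \<U> \<pi>" "0 \<le> t"
  shows "(X \<pi> x has_vector_derivative f (X \<pi> x t) (\<pi> (X \<pi> x t))) (at t within {0..})"
  using trajectory_traj[OF assms(1)] assms(2) unfolding trajectory_def by blast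

text \<open>The closed-loop dynamics are autonomous, so the time-shifted trajectory solves them from
  the state reached at time \<open>s\<close>, and uniqueness applies.\<close>

lemma traj_flow:
  assumes \<pi>: "policy \<U> \<pi>" and s: "0 \<le> s" and "0 \<le> t"
  shows "X \<pi> (X \<pi> x s) t = X \<pi> x (s + t)"
proof -
  have "((\<lambda>\<tau>. X \<pi> x (s + \<tau>)) has_vector_derivative
      f (X \<pi> x (s + t)) (\<pi> (X \<pi> x (s + t)))) (at t within {0..})" if "0 \<le> t" for t
  proof -
    have "((+) s has_vector_derivative 1) (at t within {0..})"
      by (auto intro!: derivative_eq_intros)
    moreover have "(X \<pi> x has_vector_derivative f (X \<pi> x (s + t)) (\<pi> (X \<pi> x (s + t))))
        (at (s + t) within (+) s ` {0..})"
      by (rule has_vector_derivative_within_subset[OF traj_has_vector_derivative[OF \<pi>]])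
        (use s that in auto)
    ultimately show ?thesis
      using vector_diff_chain_within by (fastforce simp: o_def)
  qed
  then have "trajectory f (\<lambda>t. \<pi>) (X \<pi> x s) (\<lambda>\<tau>. X \<pi> x (s + \<tau>))"
    unfolding trajectory_def by simp
  then show ?thesis
    using unique_policy[OF \<pi>] trajectory_traj[OF \<pi>] \<open>0 \<le> t\<close>
    unfolding unique_trajectory_def by blast
qed

lemma continuous_on_traj: "policy \<U> \<pi> \<Longrightarrow> continuous_on {0..} (X \<pi> x)"
  by (rule continuous_on_vector_derivative) (rule traj_has_vector_derivative, auto)

lemma continuous_on_along_traj:
  fixes F :: "real ^ 'l \<Rightarrow> real ^ 'm \<Rightarrow> 'c::topological_space"
  assumes \<pi>: "policy \<U> \<pi>" and F: "continuous_on (UNIV \<times> \<U>) (\<lambda>(x, u). F x u)"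
  shows "continuous_on {0..} (\<lambda>t. F (X \<pi> x t) (\<pi> (X \<pi> x t)))"
proof -
  have "continuous_on {0..} (\<lambda>t. (X \<pi> x t, \<pi> (X \<pi> x t)))"
    using \<pi> unfolding policy_def
    by (intro continuous_on_Pair continuous_on_traj[OF \<pi>]
        continuous_on_compose2[OF _ continuous_on_traj[OF \<pi>]]) auto
  then have "continuous_on {0..} (\<lambda>t. (\<lambda>(x, u). F x u) (X \<pi> x t, \<pi> (X \<pi> x t)))"
    using \<pi> unfolding policy_def by (intro continuous_on_compose2[OF F]) auto
  then show ?thesis
    by simp
qed

section \<open>Discounted returns along trajectories\<close>

lemma continuous_on_discount: "continuous_on S (\<lambda>t. \<gamma> powr t)"
  using \<gamma> by (intro continuous_on_powr continuous_on_const continuous_on_id) auto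

lemma continuous_on_disc_reward:
  "policy \<U> \<pi> \<Longrightarrow> continuous_on {0..} (\<lambda>t. \<gamma> powr t * r (X \<pi> x t) (\<pi> (X \<pi> x t)))"
  by (rule continuous_on_mult[OF continuous_on_discount continuous_on_along_traj[OF _ continuous_r]])

lemma disc_return_has_integral:
  assumes "policy \<U> \<pi>"
  shows "((\<lambda>t. \<gamma> powr t * r (X \<pi> x t) (\<pi> (X \<pi> x t))) has_integral D \<pi> x T) {0..T}"
  unfolding disc_return_def
  by (intro integrable_integral integrable_continuous_real
      continuous_on_subset[OF continuous_on_disc_reward[OF assms]]) auto

text \<open>Product rule, chain rule and the fundamental theorem of calculus. Since \<open>w\<close>
  need not be related to \<open>\<pi>\<close>, this serves for a constant (upper bound), for the
  value of \<open>\<pi>\<close> itself (evaluation) and for the value of another policy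
  (improvement).\<close>

lemma discounted_increment:
  assumes \<pi>: "policy \<U> \<pi>" and w: "C1 w" and T: "0 \<le> T"
  shows "((\<lambda>t. \<gamma> powr t * (H (X \<pi> x t) (\<pi> (X \<pi> x t)) (grad w (X \<pi> x t)) + ln \<gamma> * w (X \<pi> x t)))
    has_integral (D \<pi> x T + \<gamma> powr T * w (X \<pi> x T) - w x)) {0..T}"
proof -
  let ?X = "X \<pi> x"
  let ?f = "\<lambda>t. f (?X t) (\<pi> (?X t))"
  have "((\<lambda>t. \<gamma> powr t * w (?X t)) has_vector_derivative
      \<gamma> powr t * (grad w (?X t) \<bullet> ?f t + ln \<gamma> * w (?X t))) (at t within {0..T})"
    if "t \<in> {0..T}" for t
  proof -
    have powr: "((\<lambda>t. \<gamma> powr t) has_real_derivative \<gamma> powr t * ln \<gamma>) (at t within {0..T})"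
      using \<gamma> unfolding powr_def by (auto intro!: derivative_eq_intros)
    have "(?X has_vector_derivative ?f t) (at t within {0..T})"
      by (rule has_vector_derivative_within_subset[OF traj_has_vector_derivative[OF \<pi>]])
        (use that in auto)
    then have "((w \<circ> ?X) has_vector_derivative ?f t \<bullet> grad w (?X t)) (at t within {0..T})"
      by (rule vector_derivative_diff_chain_within)
        (rule has_derivative_at_withinI[OF C1_GDERIV[OF w, unfolded gderiv_def]])
    then have "((\<lambda>t. w (?X t)) has_real_derivative ?f t \<bullet> grad w (?X t)) (at t within {0..T})"
      by (simp add: o_def has_real_derivative_iff_has_vector_derivative)
    from DERIV_mult[OF powr this] have "((\<lambda>t. \<gamma> powr t * w (?X t)) has_real_derivative
        \<gamma> powr t * (grad w (?X t) \<bullet> ?f t + ln \<gamma> * w (?X t))) (at t within {0..T})"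
      by (rule DERIV_cong) (simp add: algebra_simps inner_commute)
    then show ?thesis
      by (simp add: has_real_derivative_iff_has_vector_derivative)
  qed
  from fundamental_theorem_of_calculus[OF T this]
  have "((\<lambda>t. \<gamma> powr t * (grad w (?X t) \<bullet> ?f t + ln \<gamma> * w (?X t))) has_integral
      \<gamma> powr T * w (?X T) - w x) {0..T}"
    using \<pi> \<gamma> by simp
  from has_integral_add[OF disc_return_has_integral[OF \<pi>, of x T] this] show ?thesis
    by (simp add: hamiltonian_def algebra_simps)
qed

text \<open>Cut the integral at \<open>s\<close>, shift the tail back to time 0 by the flow property
  and factor out \<open>\<gamma> powr s\<close>.\<close>

lemma disc_return_add:
  assumes \<pi>: "policy \<U> \<pi>" and s: "0 \<le> s" and t: "0 \<le> t"
  shows "D \<pi> x (s + t) = D \<pi> x s + \<gamma> powr s * D \<pi> (X \<pi> x s) t"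
proof -
  let ?R = "\<lambda>t. \<gamma> powr t * r (X \<pi> x t) (\<pi> (X \<pi> x t))"
  have "((\<lambda>\<tau>. \<gamma> powr s * (\<gamma> powr \<tau> * r (X \<pi> (X \<pi> x s) \<tau>) (\<pi> (X \<pi> (X \<pi> x s) \<tau>))))
      has_integral \<gamma> powr s * D \<pi> (X \<pi> x s) t) {0..t}"
    by (rule has_integral_mult_right[OF disc_return_has_integral[OF \<pi>]])
  then have "((?R \<circ> (+) s) has_integral \<gamma> powr s * D \<pi> (X \<pi> x s) t) {0..t}"
    by (rule has_integral_eq[rotated]) (use s in \<open>auto simp: traj_flow[OF \<pi>] powr_add\<close>)
  then have "(?R has_integral \<gamma> powr s * D \<pi> (X \<pi> x s) t) {s..s + t}"
    unfolding has_integral_shift_Icc_real by (simp add: add.commute)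
  from has_integral_combine[OF _ _ disc_return_has_integral[OF \<pi>] this]
  have "(?R has_integral D \<pi> x s + \<gamma> powr s * D \<pi> (X \<pi> x s) t) {0..s + t}"
    using s t by simp
  then show ?thesis
    using disc_return_has_integral[OF \<pi>] has_integral_unique by blast
qed

section \<open>Upper bound and existence of the value\<close>

text \<open>The constant \<open>B = r_max / \<alpha>\<close>, or \<open>0\<close> if \<open>\<gamma> = 1\<close>, is a supersolution of every policy
  evaluation equation, so \<open>D \<pi> x T + \<gamma> powr T * B\<close> is antitone in \<open>T\<close>.\<close>

lemma value_upper_bound:
  obtains B where "\<And>x u. u \<in> \<U> \<Longrightarrow> r x u + ln \<gamma> * B \<le> 0"
    and "((\<lambda>t. \<gamma> powr t * B) \<longlongrightarrow> 0) at_top"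
proof -
  obtain r_max where r_max: "\<And>x u. u \<in> \<U> \<Longrightarrow> r x u \<le> r_max" "\<gamma> = 1 \<Longrightarrow> r_max = 0"
    using reward_maximum unfolding is_maximum_def by blast
  show ?thesis
  proof (cases "\<gamma> = 1")
    case True
    show ?thesis
      by (rule that[of 0]) (use r_max True in auto)
  next
    case False
    then have ln: "ln \<gamma> < 0"
      using \<gamma> by simp
    have "filterlim (\<lambda>t. ln \<gamma> * t) at_bot at_top"
      using ln by (intro filterlim_tendsto_neg_mult_at_bot[OF tendsto_const]) (auto simp: filterlim_ident)
    then have "((\<lambda>t. exp (ln \<gamma> * t)) \<longlongrightarrow> 0) at_top"
      by (rule filterlim_compose[OF exp_at_bot])
    then have "((\<lambda>t. \<gamma> powr t) \<longlongrightarrow> 0) at_top"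
      using \<gamma> by (simp add: powr_def mult.commute)
    \<comment> \<open>\<open>- r_max / ln \<gamma>\<close> is r_max / \<alpha>, the return of
      receiving the maximal reward forever.\<close>
    then have "((\<lambda>t. \<gamma> powr t * (- r_max / ln \<gamma>)) \<longlongrightarrow> 0) at_top"
      by (rule tendsto_mult_left_zero)
    then show ?thesis
      by (rule that[rotated]) (use r_max ln in auto)
  qed
qed

text \<open>Justifies the \<open>Lim\<close> in \<open>value_fun\<close>: adding the vanishing term
  \<open>\<gamma> powr T * B\<close> makes the return antitone in \<open>T\<close>, hence convergent
  in \<open>ereal\<close>, with limit at most its value at \<open>T = 0\<close>.\<close>

lemma value_fun_limit:
  assumes \<pi>: "policy \<U> \<pi>"
    and B: "\<And>x u. u \<in> \<U> \<Longrightarrow> r x u + ln \<gamma> * B \<le> 0"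
    and B0: "((\<lambda>t. \<gamma> powr t * B) \<longlongrightarrow> 0) at_top"
  shows "((\<lambda>T. ereal (D \<pi> x T)) \<longlongrightarrow> value_fun f r \<gamma> \<pi> x) at_top"
    and "value_fun f r \<gamma> \<pi> x \<le> ereal B"
proof -
  define d where "d T = D \<pi> x T + \<gamma> powr T * B" for T
  have range: "\<pi> y \<in> \<U>" for y
    using \<pi> unfolding policy_def by blast
  \<comment> \<open>The increment identity for the constant \<open>B\<close>: its gradient is 0, so
    the integrand is the discounted \<open>r + ln \<gamma> * B\<close>.\<close>
  have incr: "D \<pi> y T + \<gamma> powr T * B - B \<le> 0" if "0 \<le> T" for y T
    by (rule has_integral_le[OF discounted_increment[OF \<pi> C1_const that] has_integral_0])
      (use B range \<gamma> in \<open>auto simp: hamiltonian_def grad_const intro!: mult_nonneg_nonpos\<close>)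
  have anti: "d t \<le> d s" if "0 \<le> s" "s \<le> t" for s t
  proof -
    have "d t - d s = \<gamma> powr s * (D \<pi> (X \<pi> x s) (t - s) + \<gamma> powr (t - s) * B - B)"
      using disc_return_add[OF \<pi>, of s "t - s" x] that \<gamma>
      by (simp add: d_def algebra_simps flip: powr_add)
    also have "\<dots> \<le> 0"
      using incr[of "t - s"] that by (intro mult_nonneg_nonpos) auto
    finally show ?thesis
      by simp
  qed
  have lim: "((\<lambda>T. ereal (d T)) \<longlongrightarrow> (INF T\<in>{0..}. ereal (d T))) at_top"
    by (rule antimono_on_tendsto_at_top) (use anti in auto)
  \<comment> \<open>The infimum may be minus infinity; subtraction is still continuous there because
    the subtracted limit is 0.\<close>
  have "((\<lambda>T. ereal (d T) - ereal (\<gamma> powr T * B)) \<longlongrightarrow> (INF T\<in>{0..}. ereal (d T)) - 0) at_top"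
    by (intro tendsto_diff_ereal_general lim) (use tendsto_ereal[OF B0] in \<open>auto simp: zero_ereal_def\<close>)
  then have lim': "((\<lambda>T. ereal (D \<pi> x T)) \<longlongrightarrow> (INF T\<in>{0..}. ereal (d T))) at_top"
    by (simp add: d_def)
  then have eq: "value_fun f r \<gamma> \<pi> x = (INF T\<in>{0..}. ereal (d T))"
    unfolding value_fun_def by (intro tendsto_Lim) auto
  show "((\<lambda>T. ereal (D \<pi> x T)) \<longlongrightarrow> value_fun f r \<gamma> \<pi> x) at_top"
    using lim' eq by simp
  have "value_fun f r \<gamma> \<pi> x \<le> ereal (d 0)"
    unfolding eq by (rule INF_lower) auto
  also have "\<dots> \<le> ereal B"
    using incr[of 0 x] by (simp add: d_def)
  finally show "value_fun f r \<gamma> \<pi> x \<le> ereal B" .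
qed

section \<open>Values of admissible policies\<close>

lemma admissible_policy: "admissible \<U> f r \<gamma> \<pi> \<Longrightarrow> policy \<U> \<pi>"
  unfolding admissible_def by blast

lemma value_fun_eq_val:
  assumes "admissible \<U> f r \<gamma> \<pi>"
  shows "value_fun f r \<gamma> \<pi> x = ereal (val \<pi> x)"
  using assms unfolding admissible_def val_def by (simp add: ereal_real)

lemma disc_return_tendsto_val:
  assumes "admissible \<U> f r \<gamma> \<pi>"
  shows "(D \<pi> x \<longlongrightarrow> val \<pi> x) at_top"
proof -
  obtain B where "\<And>x u. u \<in> \<U> \<Longrightarrow> r x u + ln \<gamma> * B \<le> 0"
    "((\<lambda>t. \<gamma> powr t * B) \<longlongrightarrow> 0) at_top"
    using value_upper_bound by blast
  from value_fun_limit(1)[OF admissible_policy[OF assms] this] show ?thesis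
    unfolding value_fun_eq_val[OF assms] by simp
qed

text \<open>Let the second horizon in \<open>disc_return_add\<close> tend to infinity.\<close>

lemma val_dynamic_programming:
  assumes adm: "admissible \<U> f r \<gamma> \<pi>" and s: "0 \<le> s"
  shows "val \<pi> x = D \<pi> x s + \<gamma> powr s * val \<pi> (X \<pi> x s)"
proof (rule tendsto_unique)
  show "((\<lambda>t. D \<pi> x (s + t)) \<longlongrightarrow> val \<pi> x) at_top"
    by (rule filterlim_compose[OF disc_return_tendsto_val[OF adm]])
      (intro filterlim_tendsto_add_at_top[OF tendsto_const] filterlim_ident)
  have "((\<lambda>t. D \<pi> x s + \<gamma> powr s * D \<pi> (X \<pi> x s) t) \<longlongrightarrow>
      D \<pi> x s + \<gamma> powr s * val \<pi> (X \<pi> x s)) at_top"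
    by (intro tendsto_intros disc_return_tendsto_val adm)
  then show "((\<lambda>t. D \<pi> x (s + t)) \<longlongrightarrow> D \<pi> x s + \<gamma> powr s * val \<pi> (X \<pi> x s)) at_top"
    by (rule Lim_transform_eventually)
      (auto simp: disc_return_add[OF admissible_policy[OF adm] s]
        intro: eventually_mono[OF eventually_ge_at_top[of 0]])
qed simp

section \<open>Policy evaluation in differential and integral form\<close>

lemma policy_evaluation_of_constancy:
  assumes \<pi>: "policy \<U> \<pi>" and w: "C1 w"
    and const: "\<And>T. 0 \<le> T \<Longrightarrow> w x = D \<pi> x T + \<gamma> powr T * w (X \<pi> x T)"
  shows "- ln \<gamma> * w x = H x (\<pi> x) (grad w x)"
proof -
  let ?G = "\<lambda>t. \<gamma> powr t * (H (X \<pi> x t) (\<pi> (X \<pi> x t)) (grad w (X \<pi> x t)) + ln \<gamma> * w (X \<pi> x t))"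
  have zero: "(?G has_integral 0) {0..T}" if "0 \<le> T" for T
    using discounted_increment[OF \<pi> w that, of x] const[OF that] by simp
  have grad: "continuous_on UNIV (grad w)"
    using w unfolding C1_def ..
  have F: "continuous_on (UNIV \<times> \<U>) (\<lambda>(x, u). H x u (grad w x) + ln \<gamma> * w x)"
    using continuous_r continuous_f unfolding hamiltonian_def split_beta
    by (intro continuous_intros continuous_on_compose2[OF grad]
        continuous_on_compose2[OF C1_continuous_on[OF w, of UNIV]]) auto
  have G: "continuous_on {0..1} ?G"
    by (rule continuous_on_subset[of "{0..}"])
      (auto intro!: continuous_on_mult continuous_on_discount continuous_on_along_traj[OF \<pi> F])
  \<comment> \<open>The integral function has one-sided derivative \<open>?G 0\<close> at 0 by
    continuity of \<open>?G\<close>, and derivative 0 because it vanishes identically. At time 0 the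
    state is \<open>x\<close>, which gives the equation there.\<close>
  have "((\<lambda>u. integral {0..u} ?G) has_vector_derivative ?G 0) (at 0 within {0..1})"
    by (rule integral_has_vector_derivative[OF G]) simp
  moreover have "((\<lambda>u. integral {0..u} ?G) has_vector_derivative 0) (at 0 within {0..1})"
    by (rule has_vector_derivative_transform[of _ _ _ "\<lambda>_. 0"])
      (use zero integral_unique in auto)
  ultimately have "?G 0 = 0"
    by (intro vector_derivative_unique_within_closed_interval[of 0 1 0]) auto
  then show ?thesis
    using \<pi> \<gamma> by simp
qed

text \<open>The evaluation equation makes the integrand of \<open>discounted_increment\<close>
  vanish, so return plus terminal term equals \<open>w x\<close> at every horizon; the boundary
  condition removes the terminal term in the limit.\<close>

lemma evaluation_eq_val:
  assumes adm: "admissible \<U> f r \<gamma> \<pi>" and w: "C1 w"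
    and eval: "\<And>x. - ln \<gamma> * w x = H x (\<pi> x) (grad w x)"
    and boundary: "((\<lambda>t. \<gamma> powr t * w (X \<pi> x t)) \<longlongrightarrow> 0) at_top"
  shows "w x = val \<pi> x"
proof -
  have "D \<pi> x T + \<gamma> powr T * w (X \<pi> x T) = w x" if "0 \<le> T" for T
  proof -
    have "((\<lambda>t. 0) has_integral D \<pi> x T + \<gamma> powr T * w (X \<pi> x T) - w x) {0..T}"
      using discounted_increment[OF admissible_policy[OF adm] w that, of x] by (simp flip: eval)
    then show ?thesis
      by (simp add: has_integral_0_eq)
  qed
  then have "\<forall>\<^sub>F T in at_top. D \<pi> x T + \<gamma> powr T * w (X \<pi> x T) = w x"
    by (intro eventually_mono[OF eventually_ge_at_top[of 0]]) simp
  with tendsto_add[OF disc_return_tendsto_val[OF adm, of x] boundary]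
  have "((\<lambda>T::real. w x) \<longlongrightarrow> val \<pi> x + 0) at_top"
    by (rule Lim_transform_eventually)
  then show ?thesis
    by (simp add: tendsto_const_iff)
qed

lemma integral_evaluation_eq_val:
  assumes adm: "admissible \<U> f r \<gamma> \<pi>" and \<eta>: "0 < \<eta>"
    and eval: "\<And>x. w x = D \<pi> x \<eta> + \<gamma> powr \<eta> * w (X \<pi> x \<eta>)"
    and boundary: "((\<lambda>t. \<gamma> powr t * w (X \<pi> x t)) \<longlongrightarrow> 0) at_top"
  shows "w x = val \<pi> x"
proof -
  note \<pi> = admissible_policy[OF adm]
  have iter: "w x = D \<pi> x (real n * \<eta>) + \<gamma> powr (real n * \<eta>) * w (X \<pi> x (real n * \<eta>))" for n
  proof (induction n)
    case 0
    then show ?case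
      using \<pi> \<gamma> by (simp add: disc_return_def)
  next
    case (Suc n)
    let ?s = "real n * \<eta>"
    have s: "0 \<le> ?s" "0 \<le> \<eta>"
      using \<eta> by auto
    have "w x = D \<pi> x ?s + \<gamma> powr ?s * (D \<pi> (X \<pi> x ?s) \<eta> + \<gamma> powr \<eta> * w (X \<pi> (X \<pi> x ?s) \<eta>))"
      using Suc.IH eval[of "X \<pi> x ?s"] by simp
    also have "\<dots> = D \<pi> x (?s + \<eta>) + \<gamma> powr (?s + \<eta>) * w (X \<pi> x (?s + \<eta>))"
      by (simp add: disc_return_add[OF \<pi> s] traj_flow[OF \<pi> s] powr_add distrib_left mult.assoc)
    finally show ?case
      by (simp add: algebra_simps)
  qed
  \<comment> \<open>The identity is known only at multiples of \<open>\<eta>\<close>, so both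
    continuous-time limits are sampled along them.\<close>
  have "filterlim (\<lambda>n. real n * \<eta>) at_top sequentially"
    using \<eta> by (intro filterlim_at_top_mult_tendsto_pos[OF tendsto_const] filterlim_real_sequentially)
  from filterlim_compose[OF tendsto_add[OF disc_return_tendsto_val[OF adm, of x] boundary] this]
  have "(\<lambda>n. w x) \<longlonglongrightarrow> val \<pi> x + 0"
    by (simp flip: iter)
  then show ?thesis
    by (simp add: tendsto_const_iff)
qed

section \<open>Policy improvement\<close>

lemma policy_improvement:
  assumes adm: "admissible \<U> f r \<gamma> \<pi>" and w: "C1 w" "\<And>x. w x = val \<pi> x"
    and \<pi>': "policy \<U> \<pi>'" and improve: "\<And>x. - ln \<gamma> * w x \<le> H x (\<pi>' x) (grad w x)"
  shows "admissible \<U> f r \<gamma> \<pi>'" and "w x \<le> val \<pi>' x"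
proof -
  obtain B where B: "\<And>x u. u \<in> \<U> \<Longrightarrow> r x u + ln \<gamma> * B \<le> 0"
    and B0: "((\<lambda>t. \<gamma> powr t * B) \<longlongrightarrow> 0) at_top"
    using value_upper_bound by blast
  have wB: "w x \<le> B" for x
    using value_fun_limit(2)[OF admissible_policy[OF adm] B B0, of x]
    by (simp add: w value_fun_eq_val[OF adm])
  \<comment> \<open>Along trajectories of \<open>\<pi>'\<close> the discounted \<open>w\<close> plus
    return does not decrease. The terminal term is controlled through \<open>w \<le> B\<close>,
    because the boundary condition on \<open>w\<close> concerns trajectories of the old
    policy.\<close>
  have lower: "ereal (w x) \<le> value_fun f r \<gamma> \<pi>' x" for x
  proof (rule tendsto_le)
    have "((\<lambda>T. w x - \<gamma> powr T * B) \<longlongrightarrow> w x - 0) at_top"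
      by (intro tendsto_diff tendsto_const B0)
    then show "((\<lambda>T. ereal (w x - \<gamma> powr T * B)) \<longlongrightarrow> ereal (w x)) at_top"
      by simp
    show "((\<lambda>T. ereal (D \<pi>' x T)) \<longlongrightarrow> value_fun f r \<gamma> \<pi>' x) at_top"
      by (rule value_fun_limit(1)[OF \<pi>' B B0])
    have "w x - \<gamma> powr T * B \<le> D \<pi>' x T" if "0 \<le> T" for T
    proof -
      have "0 \<le> D \<pi>' x T + \<gamma> powr T * w (X \<pi>' x T) - w x"
      proof (rule has_integral_nonneg[OF discounted_increment[OF \<pi>' w(1) that]])
        fix t
        have "0 \<le> H (X \<pi>' x t) (\<pi>' (X \<pi>' x t)) (grad w (X \<pi>' x t)) + ln \<gamma> * w (X \<pi>' x t)"
          using improve[of "X \<pi>' x t"] by simp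
        then show "0 \<le> \<gamma> powr t *
            (H (X \<pi>' x t) (\<pi>' (X \<pi>' x t)) (grad w (X \<pi>' x t)) + ln \<gamma> * w (X \<pi>' x t))"
          by simp
      qed
      moreover have "\<gamma> powr T * w (X \<pi>' x T) \<le> \<gamma> powr T * B"
        using wB by (intro mult_left_mono) auto
      ultimately show ?thesis
        by linarith
    qed
    then show "\<forall>\<^sub>F T in at_top. ereal (w x - \<gamma> powr T * B) \<le> ereal (D \<pi>' x T)"
      by (intro eventually_mono[OF eventually_ge_at_top[of 0]]) simp
  qed simp
  moreover have "value_fun f r \<gamma> \<pi>' x \<le> ereal B" for x
    by (rule value_fun_limit(2)[OF \<pi>' B B0])
  \<comment> \<open>The lower bound \<open>w x\<close> excludes minus infinity and the upper bound
    \<open>B\<close> excludes plus infinity.\<close>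
  ultimately have "\<bar>value_fun f r \<gamma> \<pi>' x\<bar> \<noteq> \<infinity>" for x
    by (metis ereal_infty_less_eq(1) ereal_infty_less_eq(2) ereal_infinity_cases PInfty_neq_ereal(1) MInfty_neq_ereal(1))
  then show adm': "admissible \<U> f r \<gamma> \<pi>'"
    using \<pi>' unfolding admissible_def by blast
  show "w x \<le> val \<pi>' x"
    using lower[of x] by (simp add: value_fun_eq_val[OF adm'])
qed

end

section \<open>Greedy actions and the limit of policy iteration\<close>

lemma argmax_iff: "u \<in> argmax S g \<longleftrightarrow> u \<in> S \<and> (\<forall>w\<in>S. g w \<le> g u)"
  by (auto simp: argmax_def is_arg_max_def not_less)

text \<open>Identifies the improvement steps of IPI and DPI: the drift term
  \<open>p \<bullet> f\<^sub>d x\<close> is constant in the action.\<close>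

lemma argmax_hamiltonian_decomposed:
  assumes "input_decomposition \<U> f f\<^sub>d f\<^sub>c"
  shows "argmax \<U> (\<lambda>u. r x u + p \<bullet> f\<^sub>c x u) = argmax \<U> (\<lambda>u. hamiltonian f r x u p)"
proof -
  have "hamiltonian f r x u p = r x u + p \<bullet> f\<^sub>c x u + p \<bullet> f\<^sub>d x" if "u \<in> \<U>" for u
    using assms that unfolding input_decomposition_def hamiltonian_def
    by (simp add: inner_add_right)
  then show ?thesis
    by (auto simp: argmax_iff)
qed

theorem theorem4p9:
  fixes \<U> :: "(real ^ 'm) set"
    and f :: "real ^ 'l \<Rightarrow> real ^ 'm \<Rightarrow> real ^ 'l"
    and r :: "real ^ 'l \<Rightarrow> real ^ 'm \<Rightarrow> real"
    and \<gamma> :: real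
    and v :: "nat \<Rightarrow> real ^ 'l \<Rightarrow> real"
    and \<pi> :: "nat \<Rightarrow> real ^ 'l \<Rightarrow> real ^ 'm"
  assumes standing: "standing_assumptions \<U> f r \<gamma>"
    and init: "admissible \<U> f r \<gamma> (\<pi> 0)"
    and iteration: "DPI \<U> f r \<gamma> v \<pi> \<or>
      (\<exists>\<eta> f\<^sub>d f\<^sub>c. \<eta> > 0 \<and> input_decomposition \<U> f f\<^sub>d f\<^sub>c \<and> IPI \<U> f r \<gamma> \<eta> f\<^sub>c v \<pi>)"
    and boundary: "\<And>i x. i \<ge> 1 \<Longrightarrow> admissible \<U> f r \<gamma> (\<pi> (i - 1)) \<Longrightarrow>
      ((\<lambda>t. \<gamma> powr t * v i (traj f (\<pi> (i - 1)) x t)) \<longlongrightarrow> 0) at_top"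
    and closed_graph: "\<And>x (p :: nat \<Rightarrow> real ^ 'l) p_star (u :: nat \<Rightarrow> real ^ 'm) u_bar.
      p \<longlonglongrightarrow> p_star \<Longrightarrow>
      (\<And>k. u k \<in> argmax \<U> (\<lambda>w. hamiltonian f r x w (p k))) \<Longrightarrow>
      u \<longlonglongrightarrow> u_bar \<Longrightarrow> u_bar \<in> \<U> \<Longrightarrow>
      u_bar \<in> argmax \<U> (\<lambda>w. hamiltonian f r x w p_star)"
    and grad_conv: "\<exists>g. locally_uniform_limit (\<lambda>i. grad (v i)) g"
    and policy_conv: "\<exists>\<pi>_lim. range \<pi>_lim \<subseteq> \<U> \<and> (\<forall>x. (\<lambda>i. \<pi> i x) \<longlonglongrightarrow> \<pi>_lim x)"
  shows "\<exists>v_star. (\<forall>x. ereal (v_star x) = (SUP i\<in>{1..}. ereal (v i x))) \<and>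
      C1 v_star \<and>
      (\<forall>x. is_maximum (- ln \<gamma> * v_star x)
             ((\<lambda>u. hamiltonian f r x u (grad v_star x)) ` \<U>)) \<and>
      locally_uniform_limit v v_star \<and>
      locally_uniform_limit (\<lambda>i. grad (v i)) (grad v_star) \<and>
      (\<exists>\<pi>_star. range \<pi>_star \<subseteq> \<U> \<and>
         (\<forall>x. (\<lambda>i. \<pi> i x) \<longlonglongrightarrow> \<pi>_star x) \<and>
         (\<forall>x. \<pi>_star x \<in> argmax \<U> (\<lambda>u. hamiltonian f r x u (grad v_star x))))"
proof -
  interpret control_problem \<U> f r \<gamma>
    by unfold_locales (rule standing)
  have evaluation: "C1 (v i) \<and> (\<forall>x. v i x = val (\<pi> (i - 1)) x) \<and>
      (\<forall>x. - ln \<gamma> * v i x = H x (\<pi> (i - 1) x) (grad (v i) x))"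
    if i: "i \<ge> 1" and adm: "admissible \<U> f r \<gamma> (\<pi> (i - 1))" for i
    using iteration
  proof
    assume "DPI \<U> f r \<gamma> v \<pi>"
    then have "C1 (v i)" and eval: "\<And>x. - ln \<gamma> * v i x = H x (\<pi> (i - 1) x) (grad (v i) x)"
      using i unfolding DPI_def by blast+
    then show ?thesis
      using evaluation_eq_val[OF adm _ eval boundary[OF i adm]] by blast
  next
    assume "\<exists>\<eta> f\<^sub>d f\<^sub>c. \<eta> > 0 \<and> input_decomposition \<U> f f\<^sub>d f\<^sub>c \<and> IPI \<U> f r \<gamma> \<eta> f\<^sub>c v \<pi>"
    then obtain \<eta> f\<^sub>c where \<eta>: "\<eta> > 0" and IPI: "IPI \<U> f r \<gamma> \<eta> f\<^sub>c v \<pi>"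
      by blast
    have C1: "C1 (v i)"
      and eval: "\<And>x. v i x = D (\<pi> (i - 1)) x \<eta> + \<gamma> powr \<eta> * v i (X (\<pi> (i - 1)) x \<eta>)"
      using IPI i unfolding IPI_def by blast+
    have val: "v i x = val (\<pi> (i - 1)) x" for x
      by (rule integral_evaluation_eq_val[OF adm \<eta> eval boundary[OF i adm]])
    \<comment> \<open>IPI gives the integral equation only at horizon \<open>\<eta>\<close>. Once
      \<open>v i\<close> is known to be the value function, dynamic programming gives it at every
      horizon, as differentiation at time 0 requires.\<close>
    have "- ln \<gamma> * v i x = H x (\<pi> (i - 1) x) (grad (v i) x)" for x
      by (rule policy_evaluation_of_constancy[OF admissible_policy[OF adm] C1])
        (unfold val, rule val_dynamic_programming[OF adm])
    then show ?thesis
      using C1 val by blast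
  qed
  have policy: "policy \<U> (\<pi> i)"
    and greedy: "\<pi> i x \<in> argmax \<U> (\<lambda>u. H x u (grad (v i) x))" if i: "i \<ge> 1" for i x
  proof -
    have "policy \<U> (\<pi> i) \<and> (\<forall>x. \<pi> i x \<in> argmax \<U> (\<lambda>u. H x u (grad (v i) x)))"
      using iteration
    proof
      assume "DPI \<U> f r \<gamma> v \<pi>"
      then show ?thesis
        using i unfolding DPI_def by blast
    next
      assume "\<exists>\<eta> f\<^sub>d f\<^sub>c. \<eta> > 0 \<and> input_decomposition \<U> f f\<^sub>d f\<^sub>c \<and> IPI \<U> f r \<gamma> \<eta> f\<^sub>c v \<pi>"
      then obtain \<eta> f\<^sub>d f\<^sub>c where dec: "input_decomposition \<U> f f\<^sub>d f\<^sub>c"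
        and IPI: "IPI \<U> f r \<gamma> \<eta> f\<^sub>c v \<pi>"
        by blast
      show ?thesis
        using IPI i unfolding IPI_def argmax_hamiltonian_decomposed[OF dec] by blast
    qed
    then show "policy \<U> (\<pi> i)" "\<pi> i x \<in> argmax \<U> (\<lambda>u. H x u (grad (v i) x))"
      by blast+
  qed

  have improvement: "admissible \<U> f r \<gamma> (\<pi> (Suc i)) \<and> (\<forall>x. v (Suc i) x \<le> val (\<pi> (Suc i)) x)"
    if adm: "admissible \<U> f r \<gamma> (\<pi> i)" for i
  proof -
    have C1: "C1 (v (Suc i))" and val: "\<And>x. v (Suc i) x = val (\<pi> i) x"
      and eval: "\<And>x. - ln \<gamma> * v (Suc i) x = H x (\<pi> i x) (grad (v (Suc i)) x)"
      using evaluation[of "Suc i"] adm by auto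
    have "\<pi> i x \<in> \<U>" for x
      using admissible_policy[OF adm] unfolding policy_def by blast
    \<comment> \<open>The old action \<open>\<pi> i x\<close> is a competitor in the maximization
      solved by \<open>\<pi> (Suc i) x\<close>.\<close>
    then have "- ln \<gamma> * v (Suc i) x \<le> H x (\<pi> (Suc i) x) (grad (v (Suc i)) x)" for x
      using greedy[of "Suc i" x] unfolding eval argmax_iff by simp
    then show ?thesis
      using policy_improvement[OF adm C1 val policy[of "Suc i"]] by simp
  qed
  \<comment> \<open>Admissibility must be propagated along the iteration, since the boundary
    condition is available only at admissible policies.\<close>
  have adm: "admissible \<U> f r \<gamma> (\<pi> i)" for i
    by (induction i) (use init improvement in auto)
  have C1: "C1 (v (Suc i))" and val: "v (Suc i) x = val (\<pi> i) x"
    and eval: "- ln \<gamma> * v (Suc i) x = H x (\<pi> i x) (grad (v (Suc i)) x)" for i x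
    using evaluation[of "Suc i"] adm[of i] by auto
  have range: "\<pi> i x \<in> \<U>" for i x
    using admissible_policy[OF adm] unfolding policy_def by blast
  \<comment> \<open>The value of \<open>\<pi> (Suc i)\<close> is \<open>v (Suc (Suc i))\<close>, so
    improvement is monotonicity of the shifted sequence.\<close>
  have mono: "incseq (\<lambda>i. v (Suc i) x)" for x
    using improvement[OF adm] by (intro incseq_SucI) (simp add: val)

  obtain B where B: "\<And>x u. u \<in> \<U> \<Longrightarrow> r x u + ln \<gamma> * B \<le> 0"
    and B0: "((\<lambda>t. \<gamma> powr t * B) \<longlongrightarrow> 0) at_top"
    using value_upper_bound by blast
  \<comment> \<open>One constant \<open>B\<close> bounds the values of all policies, so the supremum
    is finite.\<close>
  have vB: "v (Suc i) x \<le> B" for i x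
    using value_fun_limit(2)[OF admissible_policy[OF adm] B B0, of i x]
    by (simp add: val value_fun_eq_val[OF adm])
  have "\<exists>l. (\<lambda>i. v (Suc i) x) \<longlonglongrightarrow> l" for x
    using incseq_convergent[OF mono, of x B] vB by blast
  then obtain v_star where lim: "\<And>x. (\<lambda>i. v (Suc i) x) \<longlonglongrightarrow> v_star x"
    by metis
  have sup: "ereal (v_star x) = (SUP i\<in>{1..}. ereal (v i x))" for x
  proof -
    have "(\<lambda>i. ereal (v (Suc i) x)) \<longlonglongrightarrow> (SUP i. ereal (v (Suc i) x))"
      using mono[of x] by (intro LIMSEQ_SUP) (auto simp: incseq_def)
    then have "ereal (v_star x) = (SUP i. ereal (v (Suc i) x))"
      using LIMSEQ_unique tendsto_ereal[OF lim] by blast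
    also have "\<dots> = (SUP i\<in>Suc ` UNIV. ereal (v i x))"
      by (simp add: image_image)
    also have "Suc ` UNIV = {1..}"
      by (auto simp: image_iff Suc_le_eq gr0_conv_Suc)
    finally show ?thesis .
  qed

  obtain g where g: "locally_uniform_limit (\<lambda>i. grad (v i)) g"
    using grad_conv by blast
  then have g': "locally_uniform_limit (\<lambda>i. grad (v (Suc i))) g"
    using locally_uniform_limit_offset_iff[of "\<lambda>i. grad (v i)" 1 g] by simp
  note limit = C1_limit[OF C1 lim g']
  have lim_v: "locally_uniform_limit v v_star"
    using limit(3) locally_uniform_limit_offset_iff[of v 1 v_star] by simp
  have grad_lim: "(\<lambda>i. grad (v i) x) \<longlonglongrightarrow> grad v_star x" for x
  proof -
    obtain N where "x \<in> N" "uniform_limit N (\<lambda>i. grad (v i)) g sequentially"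
      using g unfolding locally_uniform_limit_def by blast
    then show ?thesis
      unfolding limit(2) by (rule tendsto_uniform_limitI[rotated])
  qed

  obtain \<pi>_star where \<pi>_range: "range \<pi>_star \<subseteq> \<U>" and \<pi>_lim: "\<And>x. (\<lambda>i. \<pi> i x) \<longlonglongrightarrow> \<pi>_star x"
    using policy_conv by blast
  \<comment> \<open>The greedy condition pairs \<open>\<pi> (Suc i)\<close> with
    \<open>v (Suc i)\<close>; both are shifted since \<open>\<pi> 0\<close> need not be
    greedy.\<close>
  have \<pi>_star: "\<pi>_star x \<in> argmax \<U> (\<lambda>u. H x u (grad v_star x))" for x
  proof (rule closed_graph)
    show "(\<lambda>i. grad (v (Suc i)) x) \<longlonglongrightarrow> grad v_star x" "(\<lambda>i. \<pi> (Suc i) x) \<longlonglongrightarrow> \<pi>_star x"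
      by (rule LIMSEQ_Suc[OF grad_lim], rule LIMSEQ_Suc[OF \<pi>_lim])
    show "\<pi> (Suc i) x \<in> argmax \<U> (\<lambda>w. H x w (grad (v (Suc i)) x))" for i
      by (rule greedy) simp
    show "\<pi>_star x \<in> \<U>"
      using \<pi>_range by blast
  qed
  \<comment> \<open>The evaluation equation pairs \<open>\<pi> i\<close> with
    \<open>v (Suc i)\<close>, one index off from the greedy condition. Convergence of the policies
    makes both pairings end at the same \<open>\<pi>_star\<close>.\<close>
  have bellman: "- ln \<gamma> * v_star x = H x (\<pi>_star x) (grad v_star x)" for x
  proof (rule LIMSEQ_unique)
    show "(\<lambda>i. - ln \<gamma> * v (Suc i) x) \<longlonglongrightarrow> - ln \<gamma> * v_star x"
      by (intro tendsto_mult tendsto_const lim)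
    have pairs: "(\<lambda>i. (x, \<pi> i x)) \<longlonglongrightarrow> (x, \<pi>_star x)"
      by (intro tendsto_Pair tendsto_const \<pi>_lim)
    \<comment> \<open>\<open>r\<close> and \<open>f\<close> are continuous only on
      \<open>UNIV \<times> \<U>\<close>, so the limit action must also lie in
      \<open>\<U>\<close>.\<close>
    have mem: "(x, \<pi>_star x) \<in> UNIV \<times> \<U>" "\<forall>\<^sub>F i in sequentially. (x, \<pi> i x) \<in> UNIV \<times> \<U>"
      using \<pi>_range range by auto
    have "(\<lambda>i. r x (\<pi> i x)) \<longlonglongrightarrow> r x (\<pi>_star x)" "(\<lambda>i. f x (\<pi> i x)) \<longlonglongrightarrow> f x (\<pi>_star x)"
      using continuous_on_tendsto_compose[OF continuous_r pairs mem]
        continuous_on_tendsto_compose[OF continuous_f pairs mem] by simp_all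
    then show "(\<lambda>i. - ln \<gamma> * v (Suc i) x) \<longlonglongrightarrow> H x (\<pi>_star x) (grad v_star x)"
      unfolding eval hamiltonian_def
      by (intro tendsto_add tendsto_inner LIMSEQ_Suc[OF grad_lim])
  qed
  have "is_maximum (- ln \<gamma> * v_star x) ((\<lambda>u. H x u (grad v_star x)) ` \<U>)" for x
    using \<pi>_star[of x] unfolding is_maximum_def argmax_iff bellman by auto
  moreover have "locally_uniform_limit (\<lambda>i. grad (v i)) (grad v_star)"
    using g limit(2) by simp
  ultimately show ?thesis
    using sup limit(1) lim_v \<pi>_range \<pi>_lim \<pi>_star by blast
qed

end
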